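(* Let $1\le m\le n$. Two labelings $\boldsymbol a,\boldsymbol a'\in L(\mathbf{A}_n^{(m)})$ are equivalent if and only if $r(\boldsymbol a)-l(\boldsymbol a)=r(\boldsymbol a')-l(\boldsymbol a')$. The values taken by the invariant $r(\boldsymbol a)-l(\boldsymbol a)$ are the integers between $-\lceil (m-1)/2\rceil$ and $\lceil (n-m)/2\rceil$.
   Context: $\mathbf{A}_n^{(m)}$ is the path graph with vertices $1,\dots,n$ (edges $\{i,i+1\}$), with vertex $m$ colored black. A labeling is $\boldsymbol a=(a_1,\dots,a_n)\in(\mathbb{Z}/2\mathbb{Z})^n$; $L(\mathbf{A}_n^{(m)})$ is the set of labelings. The augmented diagram is obtained by adding one extra vertex (the "boxed 1"), joined by an edge to vertex $m$ only, carrying the constant label $1$. For $1\le i\le n$ the move $\mathcal{M}_i$ changes only $a_i$, replacing it by $a_i$ plus the sum (in $\mathbb{Z}/2\mathbb{Z}$) of the labels of all neighbors of $i$ in the augmented diagram (including the boxed 1 when $i=m$). There is no move at the boxed vertex. Two labelings are equivalent if they are related by a finite sequence of moves. The components of a labeling are the connected components of the subgraph of the augmented diagram induced on the vertices with label $1$ (including the boxed vertex). $l(\boldsymbol a)$ is the number of components contained in $\{1,\dots,m-1\}$ and $r(\boldsymbol a)$ is the number of components contained in $\{m+1,\dots,n\}$, in both cases not counting the component that contains the boxed 1. *)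

theory Defs
  imports Complex_Main "HOL-Library.FuncSet" "HOL-Library.Z2"
begin

datatype vertex = Vertex nat | Boxed

text \<open>The labels live in the two-element field \<^typ>\<open>bit\<close>; a labeling is a function that is
  \<^const>\<open>undefined\<close> outside \<open>{1..n}\<close>, so that equality of functions is equality of labelings.\<close>

definition labelings :: "nat \<Rightarrow> (nat \<Rightarrow> bit) set" where
  "labelings n = {1..n} \<rightarrow>\<^sub>E UNIV"

definition aug_verts :: "nat \<Rightarrow> vertex set" where
  "aug_verts n = insert Boxed (Vertex ` {1..n})"

definition aug_edges :: "nat \<Rightarrow> nat \<Rightarrow> vertex set set" where
  "aug_edges n m = insert {Boxed, Vertex m} {{Vertex i, Vertex (i + 1)} | i. 1 \<le> i \<and> i < n}"

definition neighbors :: "nat \<Rightarrow> nat \<Rightarrow> vertex \<Rightarrow> vertex set" where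
  "neighbors n m v = {w \<in> aug_verts n. {v, w} \<in> aug_edges n m}"

fun aug_label :: "(nat \<Rightarrow> bit) \<Rightarrow> vertex \<Rightarrow> bit" where
  "aug_label a (Vertex i) = a i"
| "aug_label a Boxed = 1"

definition move :: "nat \<Rightarrow> nat \<Rightarrow> nat \<Rightarrow> (nat \<Rightarrow> bit) \<Rightarrow> (nat \<Rightarrow> bit)" where
  "move n m i a = a(i := a i + (\<Sum>w\<in>neighbors n m (Vertex i). aug_label a w))"

definition move_equivalent :: "nat \<Rightarrow> nat \<Rightarrow> (nat \<Rightarrow> bit) \<Rightarrow> (nat \<Rightarrow> bit) \<Rightarrow> bool" where
  "move_equivalent n m = (\<lambda>a b. \<exists>i\<in>{1..n}. b = move n m i a)\<^sup>*\<^sup>*"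

definition ones :: "nat \<Rightarrow> (nat \<Rightarrow> bit) \<Rightarrow> vertex set" where
  "ones n a = {v \<in> aug_verts n. aug_label a v = 1}"

definition ones_adj :: "nat \<Rightarrow> nat \<Rightarrow> (nat \<Rightarrow> bit) \<Rightarrow> (vertex \<times> vertex) set" where
  "ones_adj n m a = {(u, v). u \<in> ones n a \<and> v \<in> ones n a \<and> {u, v} \<in> aug_edges n m}"

definition components :: "nat \<Rightarrow> nat \<Rightarrow> (nat \<Rightarrow> bit) \<Rightarrow> vertex set set" where
  "components n m a = ones n a // (ones_adj n m a)\<^sup>*"

text \<open>A component inside \<open>Vertex ` S\<close> never contains \<^const>\<open>Boxed\<close>, so the component of the
  boxed vertex is not counted below.\<close>

definition left_count :: "nat \<Rightarrow> nat \<Rightarrow> (nat \<Rightarrow> bit) \<Rightarrow> nat" where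
  "left_count n m a = card {C \<in> components n m a. C \<subseteq> Vertex ` {1..<m}}"

definition right_count :: "nat \<Rightarrow> nat \<Rightarrow> (nat \<Rightarrow> bit) \<Rightarrow> nat" where
  "right_count n m a = card {C \<in> components n m a. C \<subseteq> Vertex ` {m<..n}}"

end

theory Submission imports Defs "HOL-Combinatorics.Transposition" begin

text \<open>Extend a labeling by \<open>0\<close> to positions \<open>0\<close> and \<open>n + 1\<close>, and let \<open>Y\<close> be the set of those
  \<open>i \<in> {0..n}\<close> for which the labels at \<open>i\<close> and \<open>i + 1\<close> differ if \<open>i < m\<close> and agree if \<open>i \<ge> m\<close>.
  The move at \<open>i\<close> exchanges the membership of \<open>i - 1\<close> and \<open>i\<close> in \<open>Y\<close>; the complementation for
  \<open>i \<ge> m\<close> absorbs the boxed \<open>1\<close>. So the moves act on \<open>Y\<close> as the adjacent transpositions of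
  \<open>{0..n}\<close>, and the labeling is determined by \<open>Y\<close>: equivalence means equal cardinality of \<open>Y\<close>.
  Components left of \<open>m\<close> correspond to the descents \<open>1, 0\<close> there and components right of \<open>m\<close> to
  the ascents \<open>0, 1\<close>, which gives \<open>card Y = 2 (l - r) + n - m + 1\<close>.\<close>

section \<open>Padded labelings and their change sets\<close>

definition pad :: "nat \<Rightarrow> (nat \<Rightarrow> bit) \<Rightarrow> nat \<Rightarrow> bit" where
  "pad n a i = (if i \<in> {1..n} then a i else 0)"

definition change_set :: "nat \<Rightarrow> nat \<Rightarrow> (nat \<Rightarrow> bit) \<Rightarrow> nat set" where
  "change_set n m a = {i \<in> {..n}. i < m \<longleftrightarrow> pad n a i \<noteq> pad n a (Suc i)}"

lemma pad_0 [simp]: "pad n a 0 = 0"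
  and pad_Suc_self [simp]: "pad n a (Suc n) = 0"
  by (auto simp: pad_def)

lemma pad_inj:
  assumes "a \<in> labelings n" "b \<in> labelings n" "\<And>i. i \<le> n \<Longrightarrow> pad n a i = pad n b i"
  shows "a = b"
proof
  fix i
  show "a i = b i"
    using assms(3)[of i] PiE_arb[OF assms(1)[unfolded labelings_def], of i]
      PiE_arb[OF assms(2)[unfolded labelings_def], of i]
    by (cases "i \<in> {1..n}") (auto simp: pad_def)
qed

lemma finite_change_set [simp]: "finite (change_set n m a)"
  by (auto simp: change_set_def)

text \<open>The labels can be read off from left to right: the padded label at \<open>0\<close> is
  \<open>0\<close>, and membership of \<open>i\<close> decides whether the label at
  \<open>Suc i\<close> repeats or flips the one at \<open>i\<close>.\<close>

lemma change_set_inj: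
  assumes "a \<in> labelings n" "b \<in> labelings n" "change_set n m a = change_set n m b"
  shows "a = b"
proof (rule pad_inj[OF assms(1,2)])
  show "pad n a i = pad n b i" if "i \<le> n" for i
    using that
  proof (induction i)
    case (Suc i)
    have "i \<in> change_set n m a \<longleftrightarrow> i \<in> change_set n m b"
      using assms(3) by simp
    then have "pad n a i \<noteq> pad n a (Suc i) \<longleftrightarrow> pad n b i \<noteq> pad n b (Suc i)"
      using Suc.prems by (auto simp: change_set_def)
    then show ?case
      using Suc by (metis Suc_leD bit_not_one_iff)
  qed simp
qed


subsection \<open>Moves\<close>

lemma neighbors_Vertex:
  assumes "i \<in> {1..n}"
  shows "neighbors n m (Vertex i) =
    Vertex ` ({i - 1, Suc i} \<inter> {1..n}) \<union> (if i = m then {Boxed} else {})"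
proof -
  obtain j where "i = Suc j" using assms by (cases i) auto
  then show ?thesis
    using assms by (auto simp: neighbors_def aug_verts_def aug_edges_def doubleton_eq_iff)
qed

text \<open>The zero padding stands in for the missing neighbors of \<open>1\<close> and
  \<open>n\<close>, so end vertices need no separate treatment later.\<close>

lemma sum_neighbors_Vertex:
  assumes "i \<in> {1..n}"
  shows "(\<Sum>w\<in>neighbors n m (Vertex i). aug_label a w) =
    pad n a (i - 1) + pad n a (Suc i) + of_bool (i = m)"
proof -
  have "(\<Sum>w\<in>neighbors n m (Vertex i). aug_label a w) =
      (\<Sum>w\<in>Vertex ` ({i - 1, Suc i} \<inter> {1..n}). aug_label a w) + of_bool (i = m)"
    unfolding neighbors_Vertex[OF assms] by (subst sum.union_disjoint) auto
  also have "(\<Sum>w\<in>Vertex ` ({i - 1, Suc i} \<inter> {1..n}). aug_label a w) =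
      (\<Sum>k\<in>{i - 1, Suc i} \<inter> {1..n}. a k)"
    by (subst sum.reindex) (auto simp: inj_on_def)
  also have "\<dots> = (\<Sum>k\<in>{i - 1, Suc i}. pad n a k)"
    by (intro sum.mono_neutral_cong_left) (auto simp: pad_def)
  finally show ?thesis by simp
qed

lemma move_in_labelings:
  assumes "a \<in> labelings n" "i \<in> {1..n}"
  shows "move n m i a \<in> labelings n"
  using assms by (auto simp: move_def labelings_def PiE_iff extensional_def)

lemma pad_move:
  assumes "i \<in> {1..n}"
  shows "pad n (move n m i a) =
    (pad n a)(i := pad n a i + (pad n a (i - 1) + pad n a (Suc i) + of_bool (i = m)))"
  using assms by (auto simp: move_def sum_neighbors_Vertex pad_def fun_eq_iff)

text \<open>With labels \<open>x\<close>, \<open>y\<close>, \<open>z\<close> at \<open>j\<close>,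
  \<open>Suc j\<close>, \<open>Suc (Suc j)\<close> and \<open>e = of_bool (Suc j = m)\<close>, the
  move turns \<open>y\<close> into \<open>x + y + z + e\<close>. Modulo 2 the differences
  \<open>x + y\<close> and \<open>y + z\<close> become \<open>y + z + e\<close> and
  \<open>x + y + e\<close>. The term \<open>e\<close> is \<open>1\<close> exactly when
  \<open>j < m\<close> but not \<open>Suc j < m\<close>, that is, when the two positions use
  opposite membership criteria.\<close>

lemma change_set_move:
  assumes "Suc j \<le> n"
  shows "change_set n m (move n m (Suc j) a) = transpose j (Suc j) -` change_set n m a"
proof (rule set_eqI)
  fix k
  let ?p = "pad n a" and ?q = "pad n (move n m (Suc j) a)"
  have q: "?q = ?p(Suc j := ?p (Suc j) + (?p j + ?p (Suc (Suc j)) + of_bool (Suc j = m)))"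
    using pad_move[of "Suc j" n m a] assms by simp
  consider "k = j" | "k = Suc j" | "k \<noteq> j" "k \<noteq> Suc j" by blast
  then show "k \<in> change_set n m (move n m (Suc j) a) \<longleftrightarrow>
      k \<in> transpose j (Suc j) -` change_set n m a"
  proof cases
    case 1
    then show ?thesis using assms unfolding change_set_def q
      by (cases "?p j"; cases "?p (Suc j)"; cases "?p (Suc (Suc j))") auto
  next
    case 2
    then show ?thesis using assms unfolding change_set_def q
      by (cases "?p j"; cases "?p (Suc j)"; cases "?p (Suc (Suc j))") auto
  next
    case 3
    then show ?thesis using assms unfolding change_set_def q by auto
  qed
qed

lemma card_change_set_move:
  assumes "i \<in> {1..n}"
  shows "card (change_set n m (move n m i a)) = card (change_set n m a)"
proof -
  obtain j where "i = Suc j" "Suc j \<le> n" using assms by (cases i) auto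
  then show ?thesis
    by (simp add: change_set_move card_vimage_inj)
qed

text \<open>A transposition is an involution on change sets, and change sets determine
  labelings.\<close>

lemma move_move:
  assumes "a \<in> labelings n" "i \<in> {1..n}"
  shows "move n m i (move n m i a) = a"
proof (rule change_set_inj)
  show "move n m i (move n m i a) \<in> labelings n" "a \<in> labelings n"
    using assms by (auto intro!: move_in_labelings)
  obtain j where "i = Suc j" "Suc j \<le> n" using assms by (cases i) auto
  then show "change_set n m (move n m i (move n m i a)) = change_set n m a"
    by (simp add: change_set_move vimage_comp)
qed

lemma move_equivalent_invariant:
  assumes "move_equivalent n m a b" "a \<in> labelings n"
  shows "b \<in> labelings n \<and> card (change_set n m b) = card (change_set n m a)"
  using assms unfolding move_equivalent_def
  by (induction rule: rtranclp_induct) (auto simp: move_in_labelings card_change_set_move)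

lemma move_equivalent_trans:
  "move_equivalent n m a b \<Longrightarrow> move_equivalent n m b c \<Longrightarrow> move_equivalent n m a c"
  unfolding move_equivalent_def by (rule rtranclp_trans)

lemma move_equivalent_move:
  "i \<in> {1..n} \<Longrightarrow> move_equivalent n m a (move n m i a)"
  unfolding move_equivalent_def by blast

text \<open>Each move undoes itself, so a path of moves can be reversed; the invariant keeps every
  intermediate function a labeling, as \<open>move_move\<close> requires.\<close>

lemma move_equivalent_sym:
  assumes "move_equivalent n m a b" "a \<in> labelings n"
  shows "move_equivalent n m b a"
  using assms(1) unfolding move_equivalent_def
proof (induction rule: rtranclp_induct)
  case (step y z)
  then obtain i where i: "i \<in> {1..n}" "z = move n m i y" by blast
  have "y \<in> labelings n"
    using move_equivalent_invariant[of n m a y] step.hyps(1) assms(2)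
    by (simp add: move_equivalent_def)
  then have "\<exists>i\<in>{1..n}. y = move n m i z" using i by (intro bexI[of _ i]) (simp_all add: move_move)
  then show ?case using step.IH by (rule converse_rtranclp_into_rtranclp)
qed simp

section \<open>Reduction of change sets to initial segments\<close>

lemma downward_closed_eq_lessThan_card:
  fixes Y :: "nat set"
  assumes "finite Y" "\<And>j. Suc j \<in> Y \<Longrightarrow> j \<in> Y"
  shows "Y = {..<card Y}"
proof -
  have down: "i \<in> Y" if "j \<in> Y" "i \<le> j" for i j
    using that(2,1) by (induction rule: inc_induct) (auto intro: assms(2))
  \<comment> \<open>\<open>k\<close> is the least number missing from \<open>Y\<close>; nothing
    above it can belong to \<open>Y\<close>.\<close>
  obtain k where k: "k \<notin> Y" "\<And>i. i < k \<Longrightarrow> i \<in> Y"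
    using ex_new_if_finite[OF infinite_UNIV_nat assms(1)] exists_least_iff[of "\<lambda>k. k \<notin> Y"]
    by blast
  then have "i \<in> Y \<longleftrightarrow> i < k" for i using down by (meson not_less)
  then have "Y = {..<k}" by auto
  then show ?thesis by simp
qed

text \<open>Moving an element of the change set down by one decreases the sum of its elements.\<close>

lemma move_equivalent_normal_form:
  assumes "a \<in> labelings n"
  shows "\<exists>b. move_equivalent n m a b \<and> change_set n m b = {..<card (change_set n m a)}"
  using assms
proof (induction "\<Sum>(change_set n m a)" arbitrary: a rule: less_induct)
  case less
  let ?Y = "change_set n m a"
  show ?case
  proof (cases "\<exists>j. Suc j \<in> ?Y \<and> j \<notin> ?Y")
    \<comment> \<open>No element can be moved down, so the change set is closed under predecessors
      and \<open>a\<close> is already in normal form.\<close>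
    case False
    then have "?Y = {..<card ?Y}"
      by (intro downward_closed_eq_lessThan_card) auto
    then show ?thesis by (auto simp: move_equivalent_def)
  next
    case True
    then obtain j where j: "Suc j \<in> ?Y" "j \<notin> ?Y" by blast
    then have n: "Suc j \<le> n" by (auto simp: change_set_def)
    let ?b = "move n m (Suc j) a"
    have Y': "change_set n m ?b = insert j (?Y - {Suc j})"
      unfolding change_set_move[OF n] using j by (auto simp: transpose_def split: if_splits)
    have "\<Sum>?Y = Suc j + \<Sum>(?Y - {Suc j})"
      using j by (simp add: sum.remove)
    moreover have "\<Sum>(change_set n m ?b) = j + \<Sum>(?Y - {Suc j})"
      unfolding Y' using j by (subst sum.insert) auto
    ultimately have "\<Sum>(change_set n m ?b) < \<Sum>?Y" by simp
    moreover have "?b \<in> labelings n" using less.prems n by (intro move_in_labelings) auto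
    ultimately obtain c where "move_equivalent n m ?b c"
        "change_set n m c = {..<card (change_set n m ?b)}"
      using less.hyps by blast
    moreover have "move_equivalent n m a ?b" using n by (intro move_equivalent_move) auto
    moreover have "card (change_set n m ?b) = card ?Y"
      using n by (intro card_change_set_move) auto
    ultimately show ?thesis by (metis move_equivalent_trans)
  qed
qed

text \<open>For the converse direction, both labelings reduce to change sets that are the same
  initial segment, hence to the same labeling; the second reduction is then run backwards.\<close>

lemma move_equivalent_iff_card:
  assumes "a \<in> labelings n" "a' \<in> labelings n"
  shows "move_equivalent n m a a' \<longleftrightarrow> card (change_set n m a) = card (change_set n m a')"
proof
  assume "move_equivalent n m a a'"
  then show "card (change_set n m a) = card (change_set n m a')"
    using move_equivalent_invariant assms(1) by metis
next
  assume eq: "card (change_set n m a) = card (change_set n m a')"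
  obtain b where b: "move_equivalent n m a b" "change_set n m b = {..<card (change_set n m a)}"
    using move_equivalent_normal_form assms(1) by blast
  obtain b' where b': "move_equivalent n m a' b'"
      "change_set n m b' = {..<card (change_set n m a')}"
    using move_equivalent_normal_form assms(2) by blast
  have "b = b'"
    using change_set_inj[of b n b' m] b b' eq assms move_equivalent_invariant by metis
  then show "move_equivalent n m a a'"
    using b(1) move_equivalent_sym[OF b'(1) assms(2)] move_equivalent_trans by blast
qed


subsection \<open>Components\<close>

text \<open>Counts the classes satisfying \<open>P\<close> by a system of representatives
  \<open>f i\<close>. It is applied to components, each represented by its end nearest to
  \<open>m\<close>.\<close>

lemma card_quotient_representatives:
  assumes "sym r" "trans r" "f ` I \<subseteq> A"
    and "\<And>i. i \<in> I \<Longrightarrow> P (r `` {f i})"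
    and "\<And>i j. i \<in> I \<Longrightarrow> j \<in> I \<Longrightarrow> (f i, f j) \<in> r \<Longrightarrow> i = j"
    and "\<And>x. x \<in> A \<Longrightarrow> (x, x) \<in> r"
    and "\<And>x. x \<in> A \<Longrightarrow> P (r `` {x}) \<Longrightarrow> \<exists>i\<in>I. (x, f i) \<in> r"
  shows "card {C \<in> A // r. P C} = card I"
proof -
  have class_eq: "r `` {x} = r `` {y}" if "(x, y) \<in> r" for x y
    using that assms(1,2) by (auto dest: symD transD)
  have "bij_betw (\<lambda>i. r `` {f i}) I {C \<in> A // r. P C}"
  proof (rule bij_betwI')
    fix i j assume ij: "i \<in> I" "j \<in> I"
    have "(f j, f j) \<in> r" using ij assms(3,6) by blast
    then show "(r `` {f i} = r `` {f j}) = (i = j)" using assms(5) ij by blast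
  next
    fix i assume "i \<in> I"
    then show "r `` {f i} \<in> {C \<in> A // r. P C}"
      using assms(3,4) by (auto intro: quotientI)
  next
    fix C assume "C \<in> {C \<in> A // r. P C}"
    then obtain x where "x \<in> A" "C = r `` {x}" "P C" by (auto elim: quotientE)
    then show "\<exists>i\<in>I. C = r `` {f i}" using assms(7) class_eq by blast
  qed
  then show ?thesis by (simp add: bij_betw_same_card)
qed

lemma sym_ones_adj: "sym (ones_adj n m a)"
  by (auto simp: sym_def ones_adj_def insert_commute)

lemma Vertex_in_ones_iff: "Vertex i \<in> ones n a \<longleftrightarrow> pad n a i = 1"
  by (auto simp: ones_def aug_verts_def pad_def)

lemma rtrancl_ones_adj_in_ones:
  "(x, y) \<in> (ones_adj n m a)\<^sup>* \<Longrightarrow> x \<in> ones n a \<Longrightarrow> y \<in> ones n a"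
  by (induction rule: rtrancl_induct) (auto simp: ones_adj_def)

lemma pad_eq_1_range: "pad n a i = 1 \<Longrightarrow> i \<in> {1..n}"
  by (auto simp: pad_def split: if_splits)

lemma ones_adj_Suc:
  assumes "pad n a i = 1" "pad n a (Suc i) = 1"
  shows "(Vertex i, Vertex (Suc i)) \<in> ones_adj n m a" "(Vertex (Suc i), Vertex i) \<in> ones_adj n m a"
proof -
  show "(Vertex i, Vertex (Suc i)) \<in> ones_adj n m a"
    using assms pad_eq_1_range[OF assms(1)] pad_eq_1_range[OF assms(2)]
    by (auto simp: ones_adj_def Vertex_in_ones_iff aug_edges_def)
  then show "(Vertex (Suc i), Vertex i) \<in> ones_adj n m a"
    using sym_ones_adj by (meson symD)
qed

lemma ones_adj_VertexE:
  assumes "(Vertex i, v) \<in> ones_adj n m a"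
  obtains "i = m" "v = Boxed"
    | "v = Vertex (Suc i)" "pad n a (Suc i) = 1"
    | j where "i = Suc j" "v = Vertex j" "pad n a j = 1"
  using assms by (auto simp: ones_adj_def aug_edges_def doubleton_eq_iff Vertex_in_ones_iff)

text \<open>A path cannot cross the \<open>0\<close> at \<open>Suc i\<close>, and it cannot escape
  through \<open>Boxed\<close>, whose only neighbor \<open>m\<close> lies beyond
  \<open>i\<close>.\<close>

lemma component_below:
  assumes "i < m" "pad n a (Suc i) = 0" "(Vertex i, v) \<in> (ones_adj n m a)\<^sup>*"
  shows "v \<in> Vertex ` {..i}"
  using assms(3)
proof (induction rule: rtrancl_induct)
  case (step y z)
  then obtain k where "y = Vertex k" "k \<le> i" by auto
  moreover have "(Vertex k, z) \<in> ones_adj n m a" using step calculation by simp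
  ultimately show ?case using assms(1,2)
    by (elim ones_adj_VertexE) (auto simp: le_eq_less_or_eq intro!: imageI)
qed simp

text \<open>The mirror image: the \<open>0\<close> at \<open>i\<close> blocks the way down, and
  \<open>m\<close> is not among the positions above \<open>i\<close>.\<close>

lemma component_above:
  assumes "m \<le> i" "pad n a i = 0" "(Vertex (Suc i), v) \<in> (ones_adj n m a)\<^sup>*"
  shows "v \<in> Vertex ` {Suc i..}"
  using assms(3)
proof (induction rule: rtrancl_induct)
  case (step y z)
  then obtain k where "y = Vertex k" "Suc i \<le> k" by auto
  moreover have "(Vertex k, z) \<in> ones_adj n m a" using step calculation by simp
  ultimately show ?case using assms(1,2)
    by (elim ones_adj_VertexE) (auto simp: le_eq_less_or_eq intro!: imageI)
qed simp

text \<open>A counted component is represented by its right end, a descent. The case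
  \<open>i = m - 1\<close> demands label \<open>0\<close> at \<open>m\<close>, which separates the
  component from \<open>m\<close> and from \<open>Boxed\<close>.\<close>

lemma left_count_eq:
  assumes "m \<le> n"
  shows "left_count n m a = card {i \<in> {..<m}. pad n a i = 1 \<and> pad n a (Suc i) = 0}"
  unfolding left_count_def components_def
proof (rule card_quotient_representatives[where f = Vertex])
  let ?R = "(ones_adj n m a)\<^sup>*" and ?I = "{i \<in> {..<m}. pad n a i = 1 \<and> pad n a (Suc i) = 0}"
  show sym: "sym ?R" by (rule sym_rtrancl[OF sym_ones_adj])
  show "trans ?R" by (rule trans_rtrancl)
  show "Vertex ` ?I \<subseteq> ones n a" by (auto simp: Vertex_in_ones_iff)
  show "(x, x) \<in> ?R" for x by simp
  show "?R `` {Vertex i} \<subseteq> Vertex ` {1..<m}" if i: "i \<in> ?I" for i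
  proof
    fix v assume v: "v \<in> ?R `` {Vertex i}"
    then obtain k where k: "v = Vertex k" "k \<le> i"
      using component_below[of i m n a v] i by auto
    moreover have "pad n a k = 1"
      using rtrancl_ones_adj_in_ones[of "Vertex i" v] v i k by (auto simp: Vertex_in_ones_iff)
    ultimately show "v \<in> Vertex ` {1..<m}" using i by (auto dest: pad_eq_1_range)
  qed
  \<comment> \<open>Two right ends of the same component bound each other from above.\<close>
  show "i = j" if "i \<in> ?I" "j \<in> ?I" "(Vertex i, Vertex j) \<in> ?R" for i j
    using component_below[of i m n a "Vertex j"] component_below[of j m n a "Vertex i"]
      that symD[OF sym that(3)] by auto
  fix x assume x: "x \<in> ones n a" "?R `` {x} \<subseteq> Vertex ` {1..<m}"
  \<comment> \<open>The positions occupied by the component of \<open>x\<close>; the maximum is its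
    right end, since a \<open>1\<close> just after it would extend the component.\<close>
  let ?K = "{k. (x, Vertex k) \<in> ?R}"
  have K: "?K \<subseteq> {1..<m}" using x(2) by auto
  then have fin: "finite ?K" by (rule finite_subset) simp
  have "?K \<noteq> {}" using x(2) by fastforce
  with fin have in_K: "(x, Vertex (Max ?K)) \<in> ?R" using Max_in by blast
  have one: "pad n a (Max ?K) = 1"
    using rtrancl_ones_adj_in_ones[OF in_K x(1)] by (simp add: Vertex_in_ones_iff)
  have "pad n a (Suc (Max ?K)) \<noteq> 1"
  proof
    assume "pad n a (Suc (Max ?K)) = 1"
    then have "Suc (Max ?K) \<in> ?K"
      using ones_adj_Suc(1)[OF one] in_K by (auto intro: rtrancl_into_rtrancl)
    then show False using Max_ge[OF fin] by fastforce
  qed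
  then show "\<exists>i\<in>?I. (x, Vertex i) \<in> ?R"
    using one in_K K by (intro bexI[of _ "Max ?K"]) auto
qed

text \<open>Here the representative is the left end, indexed by the position of the \<open>0\<close>
  before it. Hence \<open>f\<close> shifts by one, and the index \<open>m\<close> itself is
  allowed.\<close>

lemma right_count_eq:
  assumes "1 \<le> m"
  shows "right_count n m a = card {i \<in> {m..n}. pad n a i = 0 \<and> pad n a (Suc i) = 1}"
  unfolding right_count_def components_def
proof (rule card_quotient_representatives[where f = "\<lambda>i. Vertex (Suc i)"])
  let ?R = "(ones_adj n m a)\<^sup>*" and ?I = "{i \<in> {m..n}. pad n a i = 0 \<and> pad n a (Suc i) = 1}"
  show sym: "sym ?R" by (rule sym_rtrancl[OF sym_ones_adj])
  show "trans ?R" by (rule trans_rtrancl)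
  show "(\<lambda>i. Vertex (Suc i)) ` ?I \<subseteq> ones n a" by (auto simp: Vertex_in_ones_iff)
  show "(x, x) \<in> ?R" for x by simp
  show "?R `` {Vertex (Suc i)} \<subseteq> Vertex ` {m<..n}" if i: "i \<in> ?I" for i
  proof
    fix v assume v: "v \<in> ?R `` {Vertex (Suc i)}"
    then obtain k where k: "v = Vertex k" "Suc i \<le> k"
      using component_above[of m i n a v] i by auto
    moreover have "pad n a k = 1"
      using rtrancl_ones_adj_in_ones[of "Vertex (Suc i)" v] v i k by (auto simp: Vertex_in_ones_iff)
    ultimately show "v \<in> Vertex ` {m<..n}" using i by (auto dest: pad_eq_1_range)
  qed
  show "i = j" if "i \<in> ?I" "j \<in> ?I" "(Vertex (Suc i), Vertex (Suc j)) \<in> ?R" for i j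
    using component_above[of m i n a "Vertex (Suc j)"] component_above[of m j n a "Vertex (Suc i)"]
      that symD[OF sym that(3)] by auto
  fix x assume x: "x \<in> ones n a" "?R `` {x} \<subseteq> Vertex ` {m<..n}"
  let ?K = "{k. (x, Vertex k) \<in> ?R}"
  have K: "?K \<subseteq> {m<..n}" using x(2) by auto
  then have fin: "finite ?K" by (rule finite_subset) simp
  have "?K \<noteq> {}" using x(2) by fastforce
  with fin have in_K: "Min ?K \<in> ?K" by (rule Min_in)
  \<comment> \<open>All positions of the component exceed \<open>m\<close>, so the predecessor
    \<open>k\<close> of its left end is still at least \<open>m\<close>.\<close>
  then obtain k where k: "Min ?K = Suc k" "m \<le> k" "k < n"
    using K by (cases "Min ?K") auto
  have in_R: "(x, Vertex (Suc k)) \<in> ?R" using in_K k(1) by simp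
  have one: "pad n a (Suc k) = 1"
    using rtrancl_ones_adj_in_ones[OF in_R x(1)] by (simp add: Vertex_in_ones_iff)
  have "pad n a k \<noteq> 1"
  proof
    assume "pad n a k = 1"
    then have "k \<in> ?K"
      using ones_adj_Suc(2)[OF _ one] in_R by (auto intro: rtrancl_into_rtrancl)
    then show False using Min_le[OF fin] k(1) by fastforce
  qed
  then show "\<exists>i\<in>?I. (x, Vertex (Suc i)) \<in> ?R"
    using one in_R k by (intro bexI[of _ k]) auto
qed

section \<open>Cardinality of the change set\<close>

text \<open>Ascents and descents of a 0-1 sequence alternate, so the difference of their numbers
  telescopes to the difference of the end values.\<close>

lemma ascents_minus_descents:
  fixes b :: "nat \<Rightarrow> bit"
  assumes "p \<le> q"
  shows "int (card {i \<in> {p..<q}. b i = 0 \<and> b (Suc i) = 1}) + of_bool (b p = 1) =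
    int (card {i \<in> {p..<q}. b i = 1 \<and> b (Suc i) = 0}) + of_bool (b q = 1)"
  using assms
proof (induction rule: dec_induct)
  case (step k)
  have *: "{i \<in> {p..<Suc k}. P i} = (if P k then insert k else id) {i \<in> {p..<k}. P i}" for P
    using step.hyps by (auto simp: less_Suc_eq)
  show ?case
    unfolding * using step.IH by (cases "b k"; cases "b (Suc k)") auto
qed simp

text \<open>Let \<open>e\<close> be \<open>1\<close> if the label at \<open>m\<close> is
  \<open>1\<close>, and \<open>0\<close> otherwise. As the padded ends are \<open>0\<close>, there
  are \<open>2 * l + e\<close> changes before \<open>m\<close> and \<open>2 * r + e\<close> changes
  from \<open>m\<close> on, where \<open>l\<close> and \<open>r\<close> are the two counts. The
  latter are subtracted from the \<open>n - m + 1\<close> positions in \<open>{m..n}\<close>, so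
  \<open>e\<close> cancels.\<close>

lemma card_change_set:
  assumes "1 \<le> m" "m \<le> n"
  shows "int (card (change_set n m a)) =
    2 * (int (left_count n m a) - int (right_count n m a)) + int n - int m + 1"
proof -
  let ?p = "pad n a"
  define asc where "asc p q = {i \<in> {p..<q}. ?p i = 0 \<and> ?p (Suc i) = 1}" for p q
  define des where "des p q = {i \<in> {p..<q}. ?p i = 1 \<and> ?p (Suc i) = 0}" for p q
  have fin [simp]: "finite (asc p q)" "finite (des p q)" for p q
    by (auto simp: asc_def des_def)
  have disj: "asc p q \<inter> des p q = {}" for p q
    by (auto simp: asc_def des_def)
  have balance: "p \<le> q \<Longrightarrow> int (card (asc p q)) + of_bool (?p p = 1) =
      int (card (des p q)) + of_bool (?p q = 1)" for p q
    unfolding asc_def des_def by (rule ascents_minus_descents)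
  have left: "left_count n m a = card (des 0 m)"
    using assms by (simp add: left_count_eq des_def lessThan_atLeast0)
  have right: "right_count n m a = card (asc m (Suc n))"
    using assms by (simp add: right_count_eq asc_def atLeastLessThanSuc_atLeastAtMost)
  have sub: "asc m (Suc n) \<union> des m (Suc n) \<subseteq> {m..n}" by (auto simp: asc_def des_def)
  have "change_set n m a =
      (asc 0 m \<union> des 0 m) \<union> ({m..n} - (asc m (Suc n) \<union> des m (Suc n)))"
  proof (rule set_eqI)
    fix i
    show "i \<in> change_set n m a \<longleftrightarrow>
        i \<in> (asc 0 m \<union> des 0 m) \<union> ({m..n} - (asc m (Suc n) \<union> des m (Suc n)))"
      using assms unfolding change_set_def asc_def des_def
      by (cases "?p i"; cases "?p (Suc i)") auto
  qed
  also have "card \<dots> = card (asc 0 m \<union> des 0 m) + card ({m..n} - (asc m (Suc n) \<union> des m (Suc n)))"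
    by (rule card_Un_disjoint) (auto simp: asc_def des_def)
  also have "card (asc 0 m \<union> des 0 m) = card (asc 0 m) + card (des 0 m)"
    by (simp add: card_Un_disjoint disj)
  also have "card ({m..n} - (asc m (Suc n) \<union> des m (Suc n))) =
      Suc n - m - card (asc m (Suc n) \<union> des m (Suc n))"
    using sub by (simp add: card_Diff_subset)
  also have "card (asc m (Suc n) \<union> des m (Suc n)) = card (asc m (Suc n)) + card (des m (Suc n))"
    by (simp add: card_Un_disjoint disj)
  finally have "card (change_set n m a) = card (asc 0 m) + card (des 0 m) +
      (Suc n - m - (card (asc m (Suc n)) + card (des m (Suc n))))" .
  \<comment> \<open>This bound ensures that the subtraction of natural numbers is not
    truncated.\<close>
  moreover have "card (asc m (Suc n)) + card (des m (Suc n)) \<le> Suc n - m"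
    using card_mono[OF _ sub] by (simp add: card_Un_disjoint disj)
  ultimately show ?thesis
    using balance[of 0 m] balance[of m "Suc n"] assms unfolding left right by auto
qed


subsection \<open>Values of the invariant\<close>

lemma exists_labeling_right:
  assumes "1 \<le> m" "m \<le> n" "2 * v \<le> n - m + 1"
  shows "\<exists>a\<in>labelings n. left_count n m a = 0 \<and> right_count n m a = v"
proof -
  \<comment> \<open>Isolated ones at \<open>m + 1\<close>, \<open>m + 3\<close>, up to
    \<open>m + 2 * v - 1\<close>, which is at most \<open>n\<close> by the bound on
    \<open>v\<close>; vertex \<open>m\<close> keeps label \<open>0\<close>.\<close>
  define S where "S = (\<lambda>k. Suc (m + 2 * k)) ` {..<v}"
  define a :: "nat \<Rightarrow> bit" where "a = (\<lambda>i\<in>{1..n}. of_bool (i \<in> S))"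
  have "S \<subseteq> {1..n}" using assms by (auto simp: S_def)
  then have p: "pad n a i = of_bool (i \<in> S)" for i
    by (auto simp: pad_def a_def)
  have "{i \<in> {..<m}. pad n a i = 1 \<and> pad n a (Suc i) = 0} = {}"
    by (auto simp: p S_def)
  moreover have "{i \<in> {m..n}. pad n a i = 0 \<and> pad n a (Suc i) = 1} = (\<lambda>k. m + 2 * k) ` {..<v}"
    using assms by (auto simp: p S_def) presburger+
  moreover have "card ((\<lambda>k. m + 2 * k) ` {..<v}) = v"
    by (simp add: card_image inj_on_def)
  moreover have "a \<in> labelings n" by (auto simp: labelings_def a_def)
  ultimately show ?thesis
    using assms by (intro bexI[of _ a]) (auto simp: left_count_eq right_count_eq)
qed

lemma exists_labeling_left:
  assumes "1 \<le> m" "m \<le> n" "2 * v \<le> m"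
  shows "\<exists>a\<in>labelings n. left_count n m a = v \<and> right_count n m a = 0"
proof -
  \<comment> \<open>Isolated ones at \<open>m - 1\<close>, \<open>m - 3\<close>, down to
    \<open>m - 2 * v + 1\<close>, which is at least \<open>1\<close> because
    \<open>2 * v \<le> m\<close>.\<close>
  define S where "S = (\<lambda>k. m - Suc (2 * k)) ` {..<v}"
  define a :: "nat \<Rightarrow> bit" where "a = (\<lambda>i\<in>{1..n}. of_bool (i \<in> S))"
  have S: "i \<in> S \<longleftrightarrow> (\<exists>k<v. i + Suc (2 * k) = m)" for i
    using assms(3) by (auto simp: S_def intro: rev_image_eqI)
  have "S \<subseteq> {1..n}" using assms by (auto simp: S_def)
  then have p: "pad n a i = of_bool (i \<in> S)" for i
    by (auto simp: pad_def a_def)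
  have "{i \<in> {m..n}. pad n a i = 0 \<and> pad n a (Suc i) = 1} = {}"
    by (auto simp: p S)
  moreover have "{i \<in> {..<m}. pad n a i = 1 \<and> pad n a (Suc i) = 0} = S"
    by (auto simp: p S) presburger+
  moreover have "card S = v"
    unfolding S_def using assms by (subst card_image) (auto simp: inj_on_def)
  moreover have "a \<in> labelings n" by (auto simp: labelings_def a_def)
  ultimately show ?thesis
    using assms by (intro bexI[of _ a]) (auto simp: left_count_eq right_count_eq)
qed

text \<open>The bounds are \<open>0 \<le> card Y \<le> n + 1\<close> for the change set
  \<open>Y\<close>, rewritten by \<open>card_change_set\<close>. Doubling \<open>v\<close> postpones
  the rounding to the final theorem.\<close>

lemma invariant_range:
  assumes "1 \<le> m" "m \<le> n"
  shows "(\<lambda>a. int (right_count n m a) - int (left_count n m a)) ` labelings n =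
    {v. - int m \<le> 2 * v \<and> 2 * v \<le> int n - int m + 1}"
proof (intro equalityI subsetI)
  fix v assume "v \<in> (\<lambda>a. int (right_count n m a) - int (left_count n m a)) ` labelings n"
  then obtain a where v: "v = int (right_count n m a) - int (left_count n m a)" by blast
  have "change_set n m a \<subseteq> {..n}" by (auto simp: change_set_def)
  then have "card (change_set n m a) \<le> Suc n" using card_mono[of "{..n}"] by simp
  then show "v \<in> {v. - int m \<le> 2 * v \<and> 2 * v \<le> int n - int m + 1}"
    using card_change_set[OF assms, of a] v by auto
next
  fix v assume v: "v \<in> {v. - int m \<le> 2 * v \<and> 2 * v \<le> int n - int m + 1}"
  show "v \<in> (\<lambda>a. int (right_count n m a) - int (left_count n m a)) ` labelings n"
  \<comment> \<open>Nonnegative values are realized by right components alone, negative ones by left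
    components alone.\<close>
  proof (cases "v \<ge> 0")
    case True
    then have "2 * nat v \<le> n - m + 1" using v assms by auto
    from exists_labeling_right[OF assms this] show ?thesis using True by force
  next
    case False
    then have "2 * nat (- v) \<le> m" using v by auto
    from exists_labeling_left[OF assms this] show ?thesis using False by force
  qed
qed

theorem proposition7p8:
  fixes n m :: nat
  assumes "1 \<le> m" and "m \<le> n"
  shows "(\<forall>a\<in>labelings n. \<forall>a'\<in>labelings n.
            move_equivalent n m a a' \<longleftrightarrow>
              int (right_count n m a) - int (left_count n m a)
                = int (right_count n m a') - int (left_count n m a'))
       \<and> (\<lambda>a. int (right_count n m a) - int (left_count n m a)) ` labelings n
            = {- \<lceil>(real m - 1) / 2\<rceil> .. \<lceil>(real n - real m) / 2\<rceil>}"
proof (intro conjI ballI)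
  fix a a' assume "a \<in> labelings n" "a' \<in> labelings n"
  then have "move_equivalent n m a a' \<longleftrightarrow>
      int (card (change_set n m a)) = int (card (change_set n m a'))"
    by (simp add: move_equivalent_iff_card)
  then show "move_equivalent n m a a' \<longleftrightarrow>
      int (right_count n m a) - int (left_count n m a)
        = int (right_count n m a') - int (left_count n m a')"
    \<comment> \<open>The cardinality is an injective affine function of the invariant, namely
      \<open>n - m + 1\<close> minus twice its value.\<close>
    unfolding card_change_set[OF assms] by auto
next
  \<comment> \<open>Turns both ceilings into integer division, to match the doubled inequalities of
    \<open>invariant_range\<close>.\<close>
  have half: "\<lceil>real_of_int k / 2\<rceil> = (k + 1) div 2" for k :: int
  proof -
    have "k \<le> 2 * ((k + 1) div 2)" "2 * ((k + 1) div 2) \<le> k + 1" by presburger+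
    then show ?thesis by (intro ceiling_unique) linarith+
  qed
  have "\<lceil>(real m - 1) / 2\<rceil> = int m div 2"
    using half[of "int m - 1"] by simp
  moreover have "\<lceil>(real n - real m) / 2\<rceil> = (int n - int m + 1) div 2"
    using half[of "int n - int m"] by simp
  ultimately show "(\<lambda>a. int (right_count n m a) - int (left_count n m a)) ` labelings n
      = {- \<lceil>(real m - 1) / 2\<rceil> .. \<lceil>(real n - real m) / 2\<rceil>}"
    unfolding invariant_range[OF assms] by auto
qed

end
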